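(* Let $a\in(0,1]$ and $z_k=k+a-1$ for $k\ge1$. Define $\frac{1}{\tilde z_k}=\sum_{i=1}^{k-1}\frac{1}{z_i-z_k}+\sum_{i=k+1}^{\infty}\left(\frac{1}{z_i-z_k}-\frac{1}{z_i}\right)$ and $\tilde\zeta_{\mathcal Z}(s)=\sum_{n\ge1}\frac{1}{\tilde z_nz_n^{s-1}}$. Then $$\frac{1}{\tilde z_k}=\psi(k+a)-\psi(k)\quad(k\ge1),$$ and, for complex $s$ with $\operatorname{Re}(s)>2$, $$\tilde\zeta_{\mathcal Z}(s)=\zeta_H(s-1,a)\big[\psi(a+1)-\psi(1)\big]-a\sum_{l=0}^{\infty}\frac{\zeta_H(s-1,a+l+1)}{(a+l+1)(l+1)}.$$
   Context: $\psi=\Gamma'/\Gamma$ is the digamma function and $\zeta_H(s,z)=\sum_{n\ge0}(z+n)^{-s}$ is the Hurwitz zeta function. *)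

theory Defs
  imports "HOL-Analysis.Analysis"
begin

definition hurwitz_zeta :: "complex \<Rightarrow> complex \<Rightarrow> complex" where
  "hurwitz_zeta s z = (\<Sum>n. (z + of_nat n) powr (- s))"

text \<open>Sequences \<open>z\<^sub>1, z\<^sub>2, \<dots>\<close> are functions on \<open>nat\<close> whose value at 0 is never used.\<close>

definition zseq :: "real \<Rightarrow> nat \<Rightarrow> real" where
  "zseq a k = real k + a - 1"

text \<open>The summand of the tail \<open>i > k\<close>, with \<open>i = k + 1 + j\<close>.\<close>

definition recip_tilde_tail :: "(nat \<Rightarrow> real) \<Rightarrow> nat \<Rightarrow> nat \<Rightarrow> real" where
  "recip_tilde_tail z k j = 1 / (z (k + 1 + j) - z k) - 1 / z (k + 1 + j)"

text \<open>The number \<open>recip_tilde z k\<close> is the quantity written \<open>1 / z~\<^sub>k\<close>.\<close>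

definition recip_tilde :: "(nat \<Rightarrow> real) \<Rightarrow> nat \<Rightarrow> real" where
  "recip_tilde z k =
     (\<Sum>i\<in>{1..<k}. 1 / (z i - z k)) + (\<Sum>j. recip_tilde_tail z k j)"

definition tilde_zeta_term :: "(nat \<Rightarrow> real) \<Rightarrow> complex \<Rightarrow> nat \<Rightarrow> complex" where
  "tilde_zeta_term z s n = of_real (recip_tilde z n) / of_real (z n) powr (s - 1)"

definition tilde_zeta :: "(nat \<Rightarrow> real) \<Rightarrow> complex \<Rightarrow> complex" where
  "tilde_zeta z s = (\<Sum>n. tilde_zeta_term z s (Suc n))"

end

theory Submission
  imports Defs
begin

text \<open>
  The recurrence of \<open>\<psi>\<close> gives \<open>1 / z~\<^sub>n\<^sub>+\<^sub>1 = (\<psi>(a + 1) - \<psi>(1)) - a \<Sum>\<^bsub>l<n\<^esub> c\<^sub>l\<close> with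
  \<open>c\<^sub>l = 1 / ((a + l + 1) (l + 1))\<close>. Multiplying by \<open>w\<^sub>n = (a + n)\<^bsup>1 - s\<^esup>\<close> and summing over \<open>n\<close>,
  summation by parts moves the partial sums of \<open>c\<close> onto the tails
  \<open>\<Sum>\<^bsub>n>l\<^esub> w\<^sub>n\<close>, which are the Hurwitz zeta values at \<open>a + l + 1\<close>.
\<close>

lemma sums_tails_by_parts:
  fixes c w :: "nat \<Rightarrow> 'a :: {real_normed_field, banach}"
  assumes c: "summable c" and w: "summable (\<lambda>n. norm (w n))"
  shows "summable (\<lambda>n. (\<Sum>l<n. c l) * w n)"
    and "(\<lambda>l. c l * (\<Sum>m. w (m + Suc l))) sums (\<Sum>n. (\<Sum>l<n. c l) * w n)"
proof -
  define C where "C n = (\<Sum>l<n. c l)" for n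
  define T where "T n = (\<Sum>m. w (m + n))" for n
  have w': "summable w"
    using w by (rule summable_norm_cancel)
  have C_lim: "C \<longlonglongrightarrow> suminf c"
    unfolding C_def by (rule summable_LIMSEQ[OF c])
  \<comment> \<open>Convergent partial sums are bounded, so \<open>C n * w n\<close> is dominated by
    \<open>B * norm (w n)\<close>.\<close>
  obtain B where B: "norm (C n) \<le> B" for n
    using convergent_imp_Bseq[OF convergentI[OF C_lim]] unfolding Bseq_def by blast
  have summ: "summable (\<lambda>n. C n * w n)"
    by (rule summable_comparison_test'[OF summable_mult[OF w, of B], of 0])
       (auto simp: norm_mult intro!: mult_right_mono B)
  show "summable (\<lambda>n. (\<Sum>l<n. c l) * w n)"
    using summ by (simp add: C_def)
  have T_eq: "T n = suminf w - (\<Sum>l<n. w l)" for n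
    unfolding T_def by (rule suminf_minus_initial_segment[OF w'])
  have T_lim: "T \<longlonglongrightarrow> 0"
    unfolding T_def by (rule suminf_exist_split2[OF w'])
  \<comment> \<open>Finite Abel summation, from \<open>T n - T (Suc n) = w n\<close> and
    \<open>C (Suc n) - C n = c n\<close>. The boundary term \<open>C N * T N\<close> tends to 0,
    since \<open>C\<close> converges and the tails \<open>T\<close> vanish.\<close>
  have parts: "(\<Sum>l<N. c l * T (Suc l)) = (\<Sum>n<N. C n * w n) + C N * T N" for N
    by (induction N) (simp_all add: C_def T_eq algebra_simps)
  have "(\<lambda>N. (\<Sum>n<N. C n * w n) + C N * T N) \<longlonglongrightarrow> (\<Sum>n. C n * w n) + suminf c * 0"
    by (intro tendsto_intros summable_LIMSEQ summ C_lim T_lim)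
  then show "(\<lambda>l. c l * (\<Sum>m. w (m + Suc l))) sums (\<Sum>n. (\<Sum>l<n. c l) * w n)"
    unfolding sums_def T_def[symmetric] C_def[symmetric] parts by simp
qed

lemma summable_norm_shifted_powr:
  fixes a :: real and s :: complex
  assumes "0 < a" and "Re s > 1"
  shows "summable (\<lambda>n. norm (of_real (a + real n) powr (- s)))"
proof -
  have "summable (\<lambda>n. real (Suc n) powr (- Re s))"
    using assms by (subst summable_Suc_iff) (simp add: summable_real_powr_iff)
  \<comment> \<open>The comparison starts one index later: at index 0 the p-series term
    \<open>0 powr _\<close> is 0 and bounds nothing.\<close>
  then have "summable (\<lambda>n. norm (of_real (a + real (Suc n)) powr (- s)))"
  proof (rule summable_comparison_test'[where N = 0])
    fix n :: nat
    have "(a + real (Suc n)) powr (- Re s) \<le> real (Suc n) powr (- Re s)"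
      using assms by (intro powr_mono2') auto
    then show "norm (norm (of_real (a + real (Suc n)) powr (- s))) \<le> real (Suc n) powr (- Re s)"
      using assms by (simp add: norm_powr_real_powr del: of_real_add)
  qed
  then show ?thesis
    by (rule summable_Suc_iff[THEN iffD1])
qed

text \<open>Raising both arguments by one changes the difference by 1/(n+1+a) - 1/(n+1) =
  -a/((a+n+1)(n+1)), because \<psi>(x+1) = \<psi>(x) + 1/x.\<close>

lemma Digamma_diff_telescope:
  fixes a :: real
  assumes "0 < a"
  shows "Digamma (real (Suc n) + a) - Digamma (real (Suc n))
           = (Digamma (a + 1) - Digamma 1) - a * (\<Sum>l<n. 1 / ((a + real l + 1) * (real l + 1)))"
proof (induction n)
  case (Suc n)
  have "Digamma (real (Suc (Suc n)) + a) = Digamma (real (Suc n) + a) + 1 / (real (Suc n) + a)"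
    using Digamma_plus1[of "real (Suc n) + a"] assms by (simp add: algebra_simps)
  moreover have "Digamma (real (Suc (Suc n))) = Digamma (real (Suc n)) + 1 / real (Suc n)"
    using Digamma_plus1[of "real (Suc n)"] by (simp add: algebra_simps)
  moreover have "1 / (real (Suc n) + a) - 1 / real (Suc n)
                   = - a * (1 / ((a + real n + 1) * (real n + 1)))"
    using assms by (simp add: divide_simps) (simp add: algebra_simps)
  ultimately show ?case
    using Suc.IH by (simp add: algebra_simps)
qed (simp add: add.commute)

text \<open>The finite sum is minus the harmonic number H(k-1), and the tail is the series for
  \<psi>(k+a) + \<gamma>. As \<psi>(k) = H(k-1) - \<gamma>, the constant \<gamma> cancels.\<close>

lemma recip_tilde_zseq:
  fixes a :: real
  assumes "0 < a" and "k \<ge> 1"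
  shows "summable (recip_tilde_tail (zseq a) k)"
    and "recip_tilde (zseq a) k = Digamma (real k + a) - Digamma (real k)"
proof -
  \<comment> \<open>The shift a drops out of the gap between entries k+1+j and k, which is j+1,
    while entry k+1+j itself is k+a+j.\<close>
  have tail: "recip_tilde_tail (zseq a) k
                = (\<lambda>j. inverse (of_nat (Suc j)) - inverse (real k + a + of_nat j))"
    by (simp add: fun_eq_iff recip_tilde_tail_def zseq_def field_simps)
  show "summable (recip_tilde_tail (zseq a) k)"
    unfolding tail using assms by (intro summable_Digamma) auto
  have "(\<Sum>i\<in>{1..<k}. 1 / (zseq a i - zseq a k)) = - (\<Sum>i\<in>{1..<k}. inverse (real (k - i)))"
    unfolding sum_negf[symmetric]
    by (intro sum.cong) (auto simp: zseq_def divide_simps)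
  also have "(\<Sum>i\<in>{1..<k}. inverse (real (k - i))) = harm (k - 1)"
    unfolding harm_def
    by (rule sum.reindex_bij_witness[of _ "\<lambda>i. k - i" "\<lambda>i. k - i"]) auto
  finally have "recip_tilde (zseq a) k = - harm (k - 1) + (Digamma (real k + a) + euler_mascheroni)"
    by (simp add: recip_tilde_def tail Digamma_def)
  moreover have "Digamma (real k) = harm (k - 1) - euler_mascheroni"
    using Digamma_of_nat[of "k - 1", where 'a = real] assms by simp
  ultimately show "recip_tilde (zseq a) k = Digamma (real k + a) - Digamma (real k)"
    by simp
qed

theorem theorem4p1:
  fixes a :: real
  assumes "0 < a" and "a \<le> 1"
  shows "(\<forall>k\<ge>1. summable (recip_tilde_tail (zseq a) k) \<and>
            recip_tilde (zseq a) k = Digamma (real k + a) - Digamma (real k)) \<and>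
         (\<forall>s::complex. Re s > 2 \<longrightarrow>
            summable (\<lambda>n. tilde_zeta_term (zseq a) s (Suc n)) \<and>
            summable (\<lambda>l. hurwitz_zeta (s - 1) (of_real (a + real l + 1)) /
                            of_real ((a + real l + 1) * (real l + 1))) \<and>
            tilde_zeta (zseq a) s =
              hurwitz_zeta (s - 1) (of_real a) * of_real (Digamma (a + 1) - Digamma 1)
              - of_real a * (\<Sum>l. hurwitz_zeta (s - 1) (of_real (a + real l + 1)) /
                                    of_real ((a + real l + 1) * (real l + 1))))"
proof (intro conjI allI impI)
  fix k :: nat
  assume "k \<ge> 1"
  then show "summable (recip_tilde_tail (zseq a) k)"
    and "recip_tilde (zseq a) k = Digamma (real k + a) - Digamma (real k)"
    using recip_tilde_zseq assms by blast+
next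
  fix s :: complex
  assume s: "Re s > 2"
  define w where "w n = complex_of_real (a + real n) powr (- (s - 1))" for n
  define c where "c l = 1 / ((a + real l + 1) * (real l + 1))" for l
  define D where "D = Digamma (a + 1) - Digamma 1"
  have w: "summable (\<lambda>n. norm (w n))"
    unfolding w_def using assms s by (intro summable_norm_shifted_powr) auto
  have "summable (\<lambda>l. 1 / real (Suc l) ^ 2)"
    using inverse_power_summable[of 2, where 'a = real]
    by (subst summable_Suc_iff) (simp add: field_simps)
  \<comment> \<open>Since a > 0, both factors of the denominator are at least l+1.\<close>
  then have "summable c"
  proof (rule summable_comparison_test'[where N = 0])
    fix l :: nat
    show "norm (c l) \<le> 1 / real (Suc l) ^ 2"
      using assms by (auto simp: c_def power2_eq_square intro!: divide_left_mono mult_mono)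
  qed
  then have c: "summable (\<lambda>l. complex_of_real (c l))"
    by (rule summable_of_real)
  note parts = sums_tails_by_parts[OF c w]
  \<comment> \<open>Raising the second argument by n drops the first n terms of the series. The case
    n = 0 gives the factor at a, and n = l+1 gives the tails produced by summation by parts.\<close>
  have hurwitz: "hurwitz_zeta (s - 1) (of_real (a + real n)) = (\<Sum>m. w (m + n))" for n
    by (simp add: hurwitz_zeta_def w_def algebra_simps)
  have hurwitz_term: "hurwitz_zeta (s - 1) (of_real (a + real l + 1)) /
      of_real ((a + real l + 1) * (real l + 1)) = of_real (c l) * (\<Sum>m. w (m + Suc l))" for l
    using hurwitz[of "Suc l"] by (simp add: c_def add_ac)
  \<comment> \<open>Entry n+1 of the sequence is a+n, so its power is exactly \<open>w n\<close>;
    the telescoped difference supplies the coefficient.\<close>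
  have tilde_term: "tilde_zeta_term (zseq a) s (Suc n)
      = of_real D * w n - of_real a * ((\<Sum>l<n. of_real (c l)) * w n)" for n
  proof -
    have "tilde_zeta_term (zseq a) s (Suc n) = of_real (recip_tilde (zseq a) (Suc n)) * w n"
      unfolding tilde_zeta_term_def w_def powr_minus divide_inverse
      by (simp add: zseq_def add.commute)
    also have "recip_tilde (zseq a) (Suc n) = D - a * (\<Sum>l<n. c l)"
      using recip_tilde_zseq(2)[of a "Suc n"] Digamma_diff_telescope[of a n] assms
      by (simp add: D_def c_def)
    finally show ?thesis
      by (simp add: algebra_simps)
  qed
  have sums: "(\<lambda>n. tilde_zeta_term (zseq a) s (Suc n)) sums
      (of_real D * suminf w - of_real a * (\<Sum>n. (\<Sum>l<n. of_real (c l)) * w n))"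
    unfolding tilde_term
    by (intro sums_diff sums_mult summable_sums summable_norm_cancel[OF w] parts(1))
  then show "summable (\<lambda>n. tilde_zeta_term (zseq a) s (Suc n))"
    by (rule sums_summable)
  show "summable (\<lambda>l. hurwitz_zeta (s - 1) (of_real (a + real l + 1)) /
                         of_real ((a + real l + 1) * (real l + 1)))"
    unfolding hurwitz_term using parts(2) by (rule sums_summable)
  show "tilde_zeta (zseq a) s =
          hurwitz_zeta (s - 1) (of_real a) * of_real (Digamma (a + 1) - Digamma 1)
          - of_real a * (\<Sum>l. hurwitz_zeta (s - 1) (of_real (a + real l + 1)) /
                                of_real ((a + real l + 1) * (real l + 1)))"
    unfolding hurwitz_term tilde_zeta_def sums_unique[OF sums, symmetric]
      sums_unique[OF parts(2), symmetric]
    using hurwitz[of 0] by (simp add: D_def mult.commute)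
qed

end
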